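(* Let $\lambda>1$ be a natural number and let $\mathcal{EC}:\mathbb{R}^3\to\mathbb{R}^2$ be the energy-Casimir mapping $$\mathcal{EC}(x,y,z):=\left(xy^{\lambda},\ \tfrac12(x^2+y^2+z^2)\right).$$ Put $\kappa:=\lambda^{\lambda}\left(\frac{2}{\lambda+1}\right)^{\lambda+1}$. Then the image of $\mathcal{EC}$ admits the splitting $$\operatorname{Im}(\mathcal{EC})=S^{-}\cup S^{+},$$ where the subsets $S^{-},S^{+}\subset\mathbb{R}^2$ split further as the following unions of semialgebraic manifolds: $$\begin{aligned} S^{-}:=\ &\{(h,c)\in\mathbb{R}^2: h^2=\kappa c^{\lambda+1},\ h<0,\ c>0\}\cup\{(0,0)\}\cup\{(h,c)\in\mathbb{R}^2: h=0,\ c>0\}\\ &\cup\{(h,c)\in\mathbb{R}^2: h^2<\kappa c^{\lambda+1},\ h<0,\ c>0\},\\ S^{+}:=\ &\{(h,c)\in\mathbb{R}^2: h^2=\kappa c^{\lambda+1},\ h>0,\ c>0\}\cup\{(0,0)\}\cup\{(h,c)\in\mathbb{R}^2: h=0,\ c>0\}\\ &\cup\{(h,c)\in\mathbb{R}^2: h^2<\kappa c^{\lambda+1},\ h>0,\ c>0\}. \end{aligned}$$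
   Context: A semialgebraic manifold is a manifold described in coordinates by a set of algebraic equalities and inequalities. The components $H=xy^{\lambda}$ and $C=\frac12(x^2+y^2+z^2)$ of $\mathcal{EC}$ are first integrals of the rattleback system $\dot x=\lambda xz,\ \dot y=-yz,\ \dot z=y^2-\lambda x^2$. *)

theory Defs
  imports "HOL-Analysis.Analysis"
begin

definition EC :: "nat \<Rightarrow> real \<times> real \<times> real \<Rightarrow> real \<times> real" where
  "EC lam = (\<lambda>(x, y, z). (x * y ^ lam, (1/2) * (x\<^sup>2 + y\<^sup>2 + z\<^sup>2)))"

definition kappa :: "nat \<Rightarrow> real" where
  "kappa lam = real lam ^ lam * (2 / (real lam + 1)) ^ (lam + 1)"

(* C^k regularity on an open set; only meant for open S, as the derivatives are taken at x. *)
primrec Ck_on :: "nat \<Rightarrow> 'a::euclidean_space set \<Rightarrow> ('a \<Rightarrow> 'b::euclidean_space) \<Rightarrow> bool" where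
  "Ck_on 0 S f \<longleftrightarrow> continuous_on S f"
| "Ck_on (Suc k) S f \<longleftrightarrow>
     (\<exists>f'. (\<forall>x\<in>S. (f has_derivative f' x) (at x)) \<and> (\<forall>v. Ck_on k S (\<lambda>x. f' x v)))"

definition smooth_on :: "'a::euclidean_space set \<Rightarrow> ('a \<Rightarrow> 'b::euclidean_space) \<Rightarrow> bool" where
  "smooth_on S f \<longleftrightarrow> (\<forall>k. Ck_on k S f)"

definition diffeomorphism_between ::
    "'a::euclidean_space set \<Rightarrow> 'b::euclidean_space set \<Rightarrow> ('a \<Rightarrow> 'b) \<Rightarrow> bool" where
  "diffeomorphism_between U V \<phi> \<longleftrightarrow>
     bij_betw \<phi> U V \<and> smooth_on U \<phi> \<and> smooth_on V (inv_into U \<phi>)"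

(* Embedded smooth submanifold without boundary: near each of its points, M is carried to a
   d-dimensional linear subspace by a smooth change of coordinates of the ambient space. *)
definition submanifold :: "nat \<Rightarrow> 'a::euclidean_space set \<Rightarrow> bool" where
  "submanifold d M \<longleftrightarrow>
     (\<forall>p\<in>M. \<exists>(U :: 'a set) (V :: 'a set) \<phi> L. open U \<and> p \<in> U \<and> open V \<and> diffeomorphism_between U V \<phi> \<and>
        subspace L \<and> dim L = d \<and> \<phi> ` (U \<inter> M) = V \<inter> L)"

definition algebraically_described :: "'a::euclidean_space set \<Rightarrow> bool" where
  "algebraically_described M \<longleftrightarrow>
     (\<exists>E P N. finite E \<and> finite P \<and> finite N \<and>
        (\<forall>f\<in>E \<union> P \<union> N. real_polynomial_function f) \<and>
        M = {p. (\<forall>f\<in>E. f p = 0) \<and> (\<forall>f\<in>P. f p > 0) \<and> (\<forall>f\<in>N. f p \<ge> 0)})"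

definition semialgebraic_manifold :: "'a::euclidean_space set \<Rightarrow> bool" where
  "semialgebraic_manifold M \<longleftrightarrow> (\<exists>d. submanifold d M) \<and> algebraically_described M"

definition strata_minus :: "nat \<Rightarrow> (real \<times> real) set set" where
  "strata_minus lam =
     {{(h, c). h\<^sup>2 = kappa lam * c ^ (lam + 1) \<and> h < 0 \<and> c > 0},
      {(0, 0)},
      {(h, c). h = 0 \<and> c > 0},
      {(h, c). h\<^sup>2 < kappa lam * c ^ (lam + 1) \<and> h < 0 \<and> c > 0}}"

definition strata_plus :: "nat \<Rightarrow> (real \<times> real) set set" where
  "strata_plus lam =
     {{(h, c). h\<^sup>2 = kappa lam * c ^ (lam + 1) \<and> h > 0 \<and> c > 0},
      {(0, 0)},
      {(h, c). h = 0 \<and> c > 0},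
      {(h, c). h\<^sup>2 < kappa lam * c ^ (lam + 1) \<and> h > 0 \<and> c > 0}}"

definition S_minus :: "nat \<Rightarrow> (real \<times> real) set" where
  "S_minus lam = \<Union> (strata_minus lam)"

definition S_plus :: "nat \<Rightarrow> (real \<times> real) set" where
  "S_plus lam = \<Union> (strata_plus lam)"

end

theory Submission imports Defs begin

text \<open>
  The image of \<^term>\<open>EC lam\<close> is the region \<open>c \<ge> 0\<close>, \<open>h\<^sup>2 \<le> \<kappa> c ^ (\<lambda> + 1)\<close>. Indeed, \<open>h\<^sup>2 = x\<^sup>2 (y\<^sup>2) ^ \<lambda>\<close>
  is to be compared with \<open>x\<^sup>2 + y\<^sup>2 \<le> 2 c\<close>, and the weighted inequality between arithmetic and
  geometric means (\<open>weighted_am_gm\<close>) says that under this constraint the product is largest when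
  \<open>y\<^sup>2 = \<lambda> x\<^sup>2\<close>, where its value is \<open>\<kappa> c ^ (\<lambda> + 1)\<close>. Conversely, every value of \<open>h\<close> below the maximum
  is reached without any continuity argument: keep \<open>y\<close> at its optimal value \<open>y\<^sup>2 = 2 c \<lambda> / (\<lambda> + 1)\<close>,
  set \<open>x = h / y ^ \<lambda>\<close>, and let \<open>z\<close> take up the rest of \<open>2 c\<close>. Splitting this region according to the
  sign of \<open>h\<close> and to whether the inequality is strict gives the strata.

  The strata are described by polynomial conditions as they stand, so what remains is that they
  are embedded submanifolds. A point, an open set and an open half-line are flattened by the
  identity. For the boundary curves, \<open>h\<^sup>2 = \<kappa> c ^ (\<lambda> + 1)\<close> on the half-plane \<open>c > 0\<close> is solved for \<open>h\<close>,
  which makes each branch the graph of a multiple of a real power of \<open>c\<close>; the shear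
  \<open>(h, c) \<mapsto> (h - b c powr a, c)\<close> flattens this graph and is a diffeomorphism of the half-plane,
  with a shear of the same kind as its inverse.
\<close>

section \<open>Smooth maps\<close>

lemma Ck_on_cong:
  assumes "open S" "\<And>x. x \<in> S \<Longrightarrow> f x = g x" "Ck_on k S f"
  shows "Ck_on k S g"
proof (cases k)
  case 0
  with assms show ?thesis by (simp cong: continuous_on_cong)
next
  case (Suc m)
  with assms(3) obtain f' where
    f': "\<And>x. x \<in> S \<Longrightarrow> (f has_derivative f' x) (at x)" "\<And>v. Ck_on m S (\<lambda>x. f' x v)"
    by auto
  have "(g has_derivative f' x) (at x)" if "x \<in> S" for x
    using has_derivative_transform_within_open[OF f'(1)[OF that] \<open>open S\<close> that] assms(2) by blast
  with f'(2) Suc show ?thesis by auto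
qed

lemma Ck_on_const: "Ck_on k S (\<lambda>_. c)"
proof (induction k arbitrary: c)
  case (Suc k)
  show ?case
    by (auto intro!: exI[of _ "\<lambda>_ _. 0"] Suc)
qed simp

lemma smooth_on_id: "smooth_on S (\<lambda>x. x)"
  unfolding smooth_on_def
proof
  fix k show "Ck_on k S (\<lambda>x. x)"
    by (cases k) (auto intro!: exI[of _ "\<lambda>_ v. v"] Ck_on_const)
qed

text \<open>
  The class of maps in this lemma is chosen to be closed under directional derivatives: the linear
  part contributes a constant, and the power term contributes a power term with exponent \<open>a - 1\<close>
  and another coefficient vector. This closure is what makes the induction on the order of
  differentiability go through.
\<close>

lemma Ck_on_affine_plus_powr:
  fixes A :: "real \<times> real \<Rightarrow> 'b::euclidean_space" and a :: real
  assumes "bounded_linear A"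
  shows "Ck_on k {p. snd p > 0} (\<lambda>p. A p + u + (snd p powr a) *\<^sub>R w)"
  using assms
proof (induction k arbitrary: A u a w)
  case 0
  interpret bounded_linear A by fact
  show ?case
    by (auto intro!: continuous_intros continuous_on)
next
  case (Suc k)
  let ?f' = "\<lambda>p v. A v + (snd v * (a * snd p powr (a - 1))) *\<^sub>R w"
  have powr: "((\<lambda>p. snd p powr a) has_derivative (\<lambda>v. snd v * (a * snd p powr (a - 1)))) (at p)"
    if "snd p > 0" for p :: "real \<times> real"
    using DERIV_compose_FDERIV[OF has_real_derivative_powr[OF that] has_derivative_snd[OF has_derivative_ident]]
    by simp
  have "((\<lambda>p. A p + u + (snd p powr a) *\<^sub>R w) has_derivative ?f' p) (at p)" if "snd p > 0" for p
    using has_derivative_add[OF has_derivative_add[OF bounded_linear_imp_has_derivative[OF Suc.prems] has_derivative_const]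
        has_derivative_scaleR_left[OF powr[OF that]]]
    by simp
  moreover have "Ck_on k {p. snd p > 0} (\<lambda>p :: real \<times> real. ?f' p v)" for v
    using Suc.IH[OF bounded_linear_zero, of "A v" "a - 1" "(snd v * a) *\<^sub>R w"]
    by (simp add: mult_ac)
  ultimately show ?case
    unfolding Ck_on.simps by (intro exI[of _ ?f']) blast
qed

lemma smooth_on_shear:
  fixes a b :: real
  shows "smooth_on {p. snd p > 0} (\<lambda>p. (fst p + b * snd p powr a, snd p))"
proof -
  have "Ck_on k {p. snd p > 0} (\<lambda>p :: real \<times> real. p + 0 + (snd p powr a) *\<^sub>R (b, 0))" for k
    by (rule Ck_on_affine_plus_powr[OF bounded_linear_ident])
  moreover have "(\<lambda>p :: real \<times> real. p + 0 + (snd p powr a) *\<^sub>R (b, 0)) = (\<lambda>p. (fst p + b * snd p powr a, snd p))"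
    by (auto simp: prod_eq_iff)
  ultimately show ?thesis unfolding smooth_on_def by simp
qed

lemma diffeomorphism_betweenI:
  assumes "open V" "smooth_on U \<phi>" "smooth_on V \<psi>" "\<phi> ` U \<subseteq> V" "\<psi> ` V \<subseteq> U"
    and "\<And>x. x \<in> U \<Longrightarrow> \<psi> (\<phi> x) = x" "\<And>y. y \<in> V \<Longrightarrow> \<phi> (\<psi> y) = y"
  shows "diffeomorphism_between U V \<phi>"
proof -
  have bij: "bij_betw \<phi> U V"
    by (rule bij_betw_byWitness[where f' = \<psi>]) (use assms in auto)
  have "\<psi> y = inv_into U \<phi> y" if "y \<in> V" for y
    using bij assms that by (metis bij_betw_def image_subset_iff inv_into_f_f)
  then have "smooth_on V (inv_into U \<phi>)"
    using assms(1,3) Ck_on_cong unfolding smooth_on_def by blast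
  with bij assms(2) show ?thesis by (simp add: diffeomorphism_between_def)
qed

section \<open>Submanifolds\<close>

lemma submanifold_open_Int_subspace:
  assumes "open U" "subspace L"
  shows "submanifold (dim L) (U \<inter> L)"
proof -
  have "diffeomorphism_between U U (\<lambda>x. x)"
    by (rule diffeomorphism_betweenI[where \<psi> = "\<lambda>x. x"]) (auto simp: assms smooth_on_id)
  with assms show ?thesis unfolding submanifold_def
    by (intro ballI exI[of _ U] exI[of _ "\<lambda>x. x"] exI[of _ L]) auto
qed

lemma submanifold_zero: "submanifold 0 {0 :: 'a::euclidean_space}"
  using submanifold_open_Int_subspace[of UNIV "{0 :: 'a}"] by simp

lemma submanifold_open: "open U \<Longrightarrow> submanifold DIM('a) (U :: 'a::euclidean_space set)"
  using submanifold_open_Int_subspace[of U "UNIV :: 'a set"] by simp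

lemma open_upper_half_plane: "open {p :: real \<times> real. snd p > 0}"
  by (intro open_Collect_less continuous_intros)

lemma vertical_axis:
  shows subspace_vertical_axis: "subspace {p :: real \<times> real. fst p = 0}"
    and dim_vertical_axis: "dim {p :: real \<times> real. fst p = 0} = 1"
proof -
  have eq: "{p :: real \<times> real. fst p = 0} = span {(0, 1)}"
    by (auto simp: span_singleton image_iff)
  show "subspace {p :: real \<times> real. fst p = 0}" by (simp add: eq)
  show "dim {p :: real \<times> real. fst p = 0} = 1" unfolding eq by (simp add: zero_prod_def)
qed

lemma submanifold_powr_graph:
  fixes a b :: real
  shows "submanifold 1 {(h, c). c > 0 \<and> h = b * c powr a}"
    (is "submanifold 1 ?M")
proof -
  let ?H = "{p :: real \<times> real. snd p > 0}"
  let ?shear = "\<lambda>b p. (fst p + b * snd p powr a, snd p) :: real \<times> real"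
  have diffeo: "diffeomorphism_between ?H ?H (?shear (- b))"
    by (rule diffeomorphism_betweenI[where \<psi> = "?shear b"])
      (use smooth_on_shear[of "- b" a] in \<open>auto simp: open_upper_half_plane smooth_on_shear\<close>)
  have "?shear (- b) ` (?H \<inter> ?M) = ?H \<inter> {p. fst p = 0}"
  proof
    show "?H \<inter> {p. fst p = 0} \<subseteq> ?shear (- b) ` (?H \<inter> ?M)"
    proof
      fix p :: "real \<times> real" assume p: "p \<in> ?H \<inter> {p. fst p = 0}"
      then have "p = ?shear (- b) (?shear b p)" "?shear b p \<in> ?H \<inter> ?M"
        by (auto simp: prod_eq_iff)
      then show "p \<in> ?shear (- b) ` (?H \<inter> ?M)" by (rule image_eqI)
    qed
  qed auto
  with diffeo show ?thesis
    unfolding submanifold_def using open_upper_half_plane vertical_axis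
    by (intro ballI exI[of _ ?H] exI[of _ "?shear (- b)"] exI[of _ "{p. fst p = 0}"]) auto
qed

section \<open>The strata\<close>

lemma kappa_pos: "kappa lam > 0" if "lam > 0"
  using that by (simp add: kappa_def)

lemma real_polynomial_function_fst_snd:
  "real_polynomial_function (fst :: real \<times> real \<Rightarrow> real)"
  "real_polynomial_function (snd :: real \<times> real \<Rightarrow> real)"
  by (simp_all add: real_polynomial_function.intros(1) bounded_linear_fst bounded_linear_snd)

lemma algebraically_describedI:
  assumes "finite E" "finite P" "\<And>f. f \<in> E \<union> P \<Longrightarrow> real_polynomial_function f"
    and "M = {p. (\<forall>f\<in>E. f p = 0) \<and> (\<forall>f\<in>P. f p > 0)}"
  shows "algebraically_described M"
  unfolding algebraically_described_def
  by (intro exI[of _ E] exI[of _ P] exI[of _ "{}"]) (use assms in auto)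

lemma semialgebraic_origin: "semialgebraic_manifold {(0, 0) :: real \<times> real}"
proof -
  have "algebraically_described {(0, 0) :: real \<times> real}"
    by (rule algebraically_describedI[of "{fst, snd}" "{}"])
      (auto simp: real_polynomial_function_fst_snd)
  then show ?thesis
    using submanifold_zero[where 'a = "real \<times> real"]
    by (auto simp: semialgebraic_manifold_def zero_prod_def)
qed

lemma semialgebraic_half_line: "semialgebraic_manifold {(h :: real, c :: real). h = 0 \<and> c > 0}"
proof -
  have "algebraically_described {(h :: real, c :: real). h = 0 \<and> c > 0}"
    by (rule algebraically_describedI[of "{fst}" "{snd}"])
      (auto simp: real_polynomial_function_fst_snd)
  moreover have "submanifold 1 {(h :: real, c :: real). h = 0 \<and> c > 0}"
    using submanifold_powr_graph[of 0] by (simp add: conj_commute)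
  ultimately show ?thesis by (auto simp: semialgebraic_manifold_def)
qed

text \<open>
  The sign of \<open>h\<close> enters through a factor \<open>s\<close>, which is \<open>1\<close> or \<open>- 1\<close> for the strata: the conditions
  \<open>h > 0\<close> and \<open>h < 0\<close> then both say that the polynomial \<open>s * h\<close> is positive, and the two halves of
  the image are treated at once.
\<close>

lemma semialgebraic_region:
  "semialgebraic_manifold {(h, c). h\<^sup>2 < k * c ^ n \<and> s * h > 0 \<and> c > (0 :: real)}"
  (is "semialgebraic_manifold ?M")
proof -
  have M: "?M = {p. (fst p)\<^sup>2 < k * snd p ^ n \<and> s * fst p > 0 \<and> snd p > 0}" by auto
  have "algebraically_described ?M"
    by (rule algebraically_describedI[of "{}" "{\<lambda>p. k * snd p ^ n - (fst p)\<^sup>2, \<lambda>p. s * fst p, snd}"])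
      (auto intro!: real_polynomial_function_diff real_polynomial_function_power
        real_polynomial_function.intros(2,4) real_polynomial_function_fst_snd)
  moreover have "open ?M"
    unfolding M by (intro open_Collect_conj open_Collect_less continuous_intros)
  ultimately show ?thesis
    using submanifold_open unfolding semialgebraic_manifold_def by blast
qed

text \<open>
  The real power is needed for \<open>n = \<lambda> + 1\<close> odd, where \<open>h = s * sqrt (k * c ^ n)\<close> is not a polynomial in
  \<open>c\<close>. It is smooth because \<open>c > 0\<close>; the origin, where smoothness may fail, is a stratum of its own.
\<close>

lemma semialgebraic_boundary_curve:
  fixes k s :: real
  assumes "k > 0" and s: "s = 1 \<or> s = - 1"
  shows "semialgebraic_manifold {(h, c). h\<^sup>2 = k * c ^ n \<and> s * h > 0 \<and> c > (0 :: real)}"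
    (is "semialgebraic_manifold ?M")
proof -
  have "algebraically_described ?M"
    by (rule algebraically_describedI[of "{\<lambda>p. (fst p)\<^sup>2 - k * snd p ^ n}" "{\<lambda>p. s * fst p, snd}"])
      (auto intro!: real_polynomial_function_diff real_polynomial_function_power
        real_polynomial_function.intros(2,4) real_polynomial_function_fst_snd)
  moreover have "?M = {(h, c). c > 0 \<and> h = (s * sqrt k) * c powr (real n / 2)}"
  proof -
    have "h\<^sup>2 = k * c ^ n \<and> s * h > 0 \<longleftrightarrow> h = (s * sqrt k) * c powr (real n / 2)"
      if "c > 0" for h c :: real
    proof -
      define r where "r = sqrt k * c powr (real n / 2)"
      have r: "r > 0" using assms that by (simp add: r_def)
      have "(c powr (real n / 2))\<^sup>2 = c ^ n"
        using that by (simp add: powr_power powr_realpow)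
      then have "r\<^sup>2 = k * c ^ n" using assms by (simp add: r_def power_mult_distrib)
      then have "h\<^sup>2 = k * c ^ n \<longleftrightarrow> h = r \<or> h = - r" by (metis power2_eq_iff)
      moreover have "(s * sqrt k) * c powr (real n / 2) = s * r"
        by (simp add: r_def)
      moreover have "(h = r \<or> h = - r) \<and> s * h > 0 \<longleftrightarrow> h = s * r"
        using r s by auto
      ultimately show ?thesis by (simp only:)
    qed
    then show ?thesis by auto
  qed
  ultimately show ?thesis
    using submanifold_powr_graph[of "s * sqrt k" "real n / 2"]
    unfolding semialgebraic_manifold_def by auto
qed

section \<open>The image of the energy-Casimir mapping\<close>

text \<open>
  Put \<open>v = 1 - a / t\<close>. The hypothesis bounds \<open>b / (n t)\<close> by \<open>1 + v / n \<le> exp (v / n)\<close>, while \<open>a / t = 1 - v\<close>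
  is at most \<open>exp (- v)\<close>. In \<open>(a / t) (b / (n t)) ^ n\<close> the exponentials cancel.
\<close>

lemma weighted_am_gm:
  fixes a b t :: real
  assumes "n > 0" "a \<ge> 0" "b \<ge> 0" "t > 0" and le: "a + b \<le> (real n + 1) * t"
  shows "a * b ^ n \<le> real n ^ n * t ^ (n + 1)"
proof -
  define v where "v = 1 - a / t"
  have "a / t \<le> exp (- v)"
    using exp_ge_add_one_self[of "- v"] by (simp add: v_def)
  moreover have "b / (n * t) \<le> 1 + v / n"
    using assms by (simp add: v_def field_simps)
  then have "b / (n * t) \<le> exp (v / n)"
    using exp_ge_add_one_self[of "v / n"] by linarith
  then have "(b / (n * t)) ^ n \<le> exp (v / n) ^ n"
    using assms by (intro power_mono) auto
  then have "(b / (n * t)) ^ n \<le> exp v"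
    using assms by (simp flip: exp_of_nat_mult)
  ultimately have "a / t * (b / (n * t)) ^ n \<le> exp (- v) * exp v"
    using assms by (intro mult_mono) auto
  then have "a / t * (b / (n * t)) ^ n \<le> 1"
    by (simp flip: exp_add)
  then show ?thesis
    using assms by (simp add: power_divide power_mult_distrib field_simps)
qed

lemma kappa_mult_power:
  "kappa lam * c ^ (lam + 1) = real lam ^ lam * (2 * c / (real lam + 1)) ^ (lam + 1)"
  by (simp add: kappa_def power_mult_distrib power_divide)

lemma EC_bound:
  assumes "lam > 0"
  shows "(x * y ^ lam)\<^sup>2 \<le> kappa lam * ((1/2) * (x\<^sup>2 + y\<^sup>2 + z\<^sup>2)) ^ (lam + 1)"
proof -
  define c where "c = (1/2) * (x\<^sup>2 + y\<^sup>2 + z\<^sup>2)"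
  have sq: "(x * y ^ lam)\<^sup>2 = x\<^sup>2 * (y\<^sup>2) ^ lam"
    by (simp add: power_mult_distrib power_mult mult.commute flip: power_mult)
  show ?thesis
  proof (cases "c = 0")
    case True
    then have "x\<^sup>2 + (y\<^sup>2 + z\<^sup>2) = 0" by (simp add: c_def)
    then have "x\<^sup>2 = 0" by (simp add: add_nonneg_eq_0_iff)
    with True show ?thesis by (simp add: c_def)
  next
    case False
    then have "c > 0" by (simp add: c_def order_less_le)
    have "x\<^sup>2 + y\<^sup>2 \<le> 2 * c" by (simp add: c_def)
    then have "x\<^sup>2 * (y\<^sup>2) ^ lam \<le> real lam ^ lam * (2 * c / (real lam + 1)) ^ (lam + 1)"
      using assms \<open>c > 0\<close> by (intro weighted_am_gm) auto
    then show ?thesis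
      unfolding sq kappa_mult_power[symmetric] c_def .
  qed
qed

text \<open>
  The factor \<open>y\<close> is placed where \<open>x\<^sup>2 (y\<^sup>2) ^ \<lambda>\<close> is maximal on the circle \<open>x\<^sup>2 + y\<^sup>2 = 2 c\<close>, so the bound on
  \<open>h\<^sup>2\<close> turns exactly into the bound \<open>x\<^sup>2 \<le> 2 c - y\<^sup>2\<close> that leaves room for \<open>z\<close>.
\<close>

lemma EC_attains:
  assumes "lam > 0" "c > 0" and le: "h\<^sup>2 \<le> kappa lam * c ^ (lam + 1)"
  shows "(h, c) \<in> range (EC lam)"
proof -
  define t where "t = 2 * c / (real lam + 1)"
  define y where "y = sqrt (lam * t)"
  define x where "x = h / y ^ lam"
  define z where "z = sqrt (2 * c - x\<^sup>2 - y\<^sup>2)"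
  have t: "t > 0" "(real lam + 1) * t = 2 * c"
    using assms by (auto simp: t_def intro!: divide_pos_pos)
  then have sum: "lam * t + t = 2 * c" by (simp add: distrib_right)
  have y: "y > 0" "y\<^sup>2 = lam * t"
    using assms t by (auto simp: y_def)
  have "(y ^ lam)\<^sup>2 = (lam * t) ^ lam"
    using y(2) by (metis mult.commute power_mult)
  moreover have "h\<^sup>2 \<le> t * (lam * t) ^ lam"
    using le unfolding kappa_mult_power t_def[symmetric] by (simp add: power_mult_distrib mult_ac)
  ultimately have "x\<^sup>2 \<le> t"
    using assms t(1) by (simp add: x_def power_divide divide_le_eq)
  then have "z\<^sup>2 = 2 * c - x\<^sup>2 - y\<^sup>2"
    using sum y by (simp add: z_def)
  then have "EC lam (x, y, z) = (h, c)"
    using y by (simp add: EC_def x_def)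
  then show ?thesis by (metis rangeI)
qed

lemma range_EC:
  assumes "lam > 0"
  shows "range (EC lam) = {(h, c). c \<ge> 0 \<and> h\<^sup>2 \<le> kappa lam * c ^ (lam + 1)}" (is "_ = ?R")
proof
  show "range (EC lam) \<subseteq> ?R"
    using EC_bound[OF assms] by (auto simp: EC_def)
  show "?R \<subseteq> range (EC lam)"
  proof clarify
    fix h c assume hc: "0 \<le> c" "h\<^sup>2 \<le> kappa lam * c ^ (lam + 1)"
    show "(h, c) \<in> range (EC lam)"
    proof (cases "c = 0")
      case True
      then have "EC lam (0, 0, 0) = (h, c)" using hc by (simp add: EC_def)
      then show ?thesis by (metis rangeI)
    qed (use EC_attains assms hc in auto)
  qed
qed

lemma S_minus_Un_S_plus:
  assumes "lam > 0"
  shows "S_minus lam \<union> S_plus lam = {(h, c). c \<ge> 0 \<and> h\<^sup>2 \<le> kappa lam * c ^ (lam + 1)}"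
proof -
  have "(h, c) \<in> S_minus lam \<union> S_plus lam \<longleftrightarrow> c \<ge> 0 \<and> h\<^sup>2 \<le> kappa lam * c ^ (lam + 1)" for h c
  proof -
    have "kappa lam * c ^ (lam + 1) > 0" if "c > 0"
      using that kappa_pos[OF assms] by simp
    moreover have "kappa lam * c ^ (lam + 1) = 0" if "c = 0"
      using that by simp
    moreover have "h\<^sup>2 \<le> 0 \<longleftrightarrow> h = 0" by simp
    ultimately show ?thesis
      unfolding S_minus_def S_plus_def strata_minus_def strata_plus_def Union_insert Union_empty
        Un_iff mem_Collect_eq prod.case insert_iff empty_iff prod.inject
      by (smt (verit) zero_power2)
  qed
  then show ?thesis by auto
qed

theorem proposition5p1:
  fixes lam :: nat
  assumes "lam > 1"
  shows "range (EC lam) = S_minus lam \<union> S_plus lam \<and>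
         (\<forall>M \<in> strata_minus lam. semialgebraic_manifold M) \<and>
         (\<forall>M \<in> strata_plus lam. semialgebraic_manifold M)"
proof (intro conjI)
  have lam: "lam > 0" using assms by simp
  show "range (EC lam) = S_minus lam \<union> S_plus lam"
    using range_EC[OF lam] S_minus_Un_S_plus[OF lam] by simp
  show "\<forall>M \<in> strata_minus lam. semialgebraic_manifold M"
    using semialgebraic_boundary_curve[OF kappa_pos[OF lam], of "- 1" "lam + 1"]
      semialgebraic_region[of "kappa lam" "lam + 1" "- 1"]
      semialgebraic_origin semialgebraic_half_line
    by (simp add: strata_minus_def)
  show "\<forall>M \<in> strata_plus lam. semialgebraic_manifold M"
    using semialgebraic_boundary_curve[OF kappa_pos[OF lam], of 1 "lam + 1"]
      semialgebraic_region[of "kappa lam" "lam + 1" 1]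
      semialgebraic_origin semialgebraic_half_line
    by (simp add: strata_plus_def)
qed

end
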